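(* Let $K$ be a field, $n>1$, $A=K[x_1,\dots,x_n]$, $d\ge2$, and $\mathcal D=\{A_{d-1}y\mid 0\ne y\in A_1\}$. Then $\mathcal D$ is a generalized dual arc in $A_d$ with vector dimensions $\big(\binom{n+d-1}{d},\binom{n+d-2}{d-1},\dots,n_{d-1}=\binom{n}{1}=n,\,n_d=1\big)$, i.e. each member of $\mathcal D$ has dimension $\binom{n+d-2}{d-1}$, the intersection of any $j$ distinct members ($2\le j\le d$) has dimension $n_j=\binom{n+d-j-1}{d-j}$, and the intersection of any $d+1$ distinct members is $0$.
   Context: $A_m$ is the space of homogeneous polynomials of degree $m$ in $A$, of dimension $\binom{n+m-1}{m}$; $A_{d-1}y=\{gy\mid g\in A_{d-1}\}$. A generalized dual arc of an $N$-dimensional space $V$ with vector dimensions $(N,n_1,\dots,n_d)$ is a set $\mathcal D$ of $n_1$-dimensional subspaces of $V$ such that the intersection of any $j$ distinct members has dimension $n_j>0$ for $j=2,\dots,d$, and the intersection of any $d+1$ distinct members is $0$. *)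

theory Defs
  imports "HOL-Library.Poly_Mapping" "HOL.Vector_Spaces"
begin

context vector_space
begin

text \<open>The vector dimensions \<open>(N, n\<^sub>1, \<dots>, n\<^sub>d)\<close> are given by \<open>d\<close>, \<open>N\<close> and a function \<open>nd\<close>
  of which only the values \<open>nd 1, \<dots>, nd d\<close> matter. The spanning set is demanded because
  \<^const>\<open>dim\<close> is \<open>0\<close> on infinite-dimensional spaces.\<close>

definition generalized_dual_arc :: "'b set \<Rightarrow> nat \<Rightarrow> nat \<Rightarrow> (nat \<Rightarrow> nat) \<Rightarrow> 'b set set \<Rightarrow> bool"
  where "generalized_dual_arc V d N nd D \<longleftrightarrow>
    subspace V \<and> (\<exists>B. finite B \<and> span B = V) \<and> dim V = N \<and>
    (\<forall>U\<in>D. subspace U \<and> U \<subseteq> V \<and> dim U = nd 1) \<and>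
    (\<forall>j\<in>{2..d}. nd j > 0 \<and> (\<forall>S\<subseteq>D. card S = j \<longrightarrow> dim (\<Inter>S) = nd j)) \<and>
    (\<forall>S\<subseteq>D. card S = d + 1 \<longrightarrow> \<Inter>S = {0})"

end

text \<open>A monomial is its exponent vector; a polynomial is a finitely supported map from monomials
  to coefficients, with the convolution product of the library.\<close>

type_synonym 'k mpoly = "(nat \<Rightarrow>\<^sub>0 nat) \<Rightarrow>\<^sub>0 'k"

definition scale_mpoly :: "'k::field \<Rightarrow> 'k mpoly \<Rightarrow> 'k mpoly"
  where "scale_mpoly c p = Poly_Mapping.map (\<lambda>a. c * a) p"

lemma lookup_scale_mpoly: "Poly_Mapping.lookup (scale_mpoly c p) m = c * Poly_Mapping.lookup p m"
  by (simp add: scale_mpoly_def Poly_Mapping.map.rep_eq when_def)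

global_interpretation mpoly: vector_space scale_mpoly
  by unfold_locales (auto intro!: poly_mapping_eqI simp: lookup_scale_mpoly lookup_add algebra_simps)

definition mpolys :: "nat \<Rightarrow> 'k::field mpoly set"
  where "mpolys n = {p. \<forall>m \<in> Poly_Mapping.keys p. Poly_Mapping.keys m \<subseteq> {1..n}}"

definition monom_degree :: "(nat \<Rightarrow>\<^sub>0 nat) \<Rightarrow> nat"
  where "monom_degree m = (\<Sum>i\<in>Poly_Mapping.keys m. Poly_Mapping.lookup m i)"

definition homogeneous :: "nat \<Rightarrow> nat \<Rightarrow> 'k::field mpoly set"
  where "homogeneous n k = {p \<in> mpolys n. \<forall>m \<in> Poly_Mapping.keys p. monom_degree m = k}"

end

theory Submission
  imports Defs
begin

text \<open>A nonzero linear form \<open>y\<close> with nonzero coefficient at \<open>x\<^sub>k\<close> allows division with remainder: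
  \<open>h = q y + r\<close> with \<open>r\<close> free of \<open>x\<^sub>k\<close>, and no nonzero multiple of \<open>y\<close> is free of \<open>x\<^sub>k\<close>. Hence linear
  forms are prime, and a form divisible by pairwise non-associated linear forms
  \<open>y\<^sub>1, \<dots>, y\<^sub>j\<close> is divisible by their product. So the intersection of \<open>j\<close> members of the arc is
  \<open>A\<^bsub>d-j\<^esub> y\<^sub>1 \<cdots> y\<^sub>j\<close>, which has the dimension of \<open>A\<^bsub>d-j\<^esub>\<close>, and which is \<open>0\<close> when \<open>j > d\<close>.\<close>

subsection \<open>Polynomials supported on a set of monomials\<close>

text \<open>Forms of a given degree and polynomials free of a variable both have this shape, so
  closure, spans and dimensions are treated once for an arbitrary set of monomials.\<close>

definition polys_on :: "(nat \<Rightarrow>\<^sub>0 nat) set \<Rightarrow> 'k::field mpoly set"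
  where "polys_on M = {p. Poly_Mapping.keys p \<subseteq> M}"

text \<open>Identities that mix scalar and ring multiplication become plain ring identities.\<close>

lemma scale_mpoly_conv_mult: "scale_mpoly c p = Poly_Mapping.single 0 c * p"
  unfolding scale_mpoly_def by (rule mult_map_scale_conv_mult)

lemma polys_on_iff: "p \<in> polys_on M \<longleftrightarrow> (\<forall>m. m \<notin> M \<longrightarrow> Poly_Mapping.lookup p m = 0)"
  by (auto simp: polys_on_def in_keys_iff)

lemma subspace_polys_on: "mpoly.subspace (polys_on M)"
  by (rule mpoly.subspaceI) (auto simp: polys_on_iff lookup_add lookup_scale_mpoly)

lemma zero_in_polys_on [simp]: "0 \<in> polys_on M"
  by (simp add: polys_on_iff)

lemma single_in_polys_on: "m \<in> M \<Longrightarrow> Poly_Mapping.single m c \<in> polys_on M"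
  by (auto simp: polys_on_def)

lemma times_in_polys_on:
  assumes "p \<in> polys_on M" "q \<in> polys_on N" "\<And>a b. a \<in> M \<Longrightarrow> b \<in> N \<Longrightarrow> a + b \<in> L"
  shows "p * q \<in> polys_on L"
  using assms keys_mult[of p q] by (fastforce simp: polys_on_def)

section \<open>The monomial basis and dimensions\<close>

lemma mpoly_sum_monomials:
  "p = (\<Sum>m\<in>Poly_Mapping.keys p. scale_mpoly (Poly_Mapping.lookup p m) (Poly_Mapping.single m 1))"
  by (rule poly_mapping_eqI)
     (auto simp: lookup_sum lookup_scale_mpoly lookup_single when_def in_keys_iff if_distrib
           cong: if_cong)

lemma span_monomials: "mpoly.span ((\<lambda>m. Poly_Mapping.single m 1) ` M) = polys_on M"
proof (rule mpoly.span_unique)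
  show "(\<lambda>m. Poly_Mapping.single m 1) ` M \<subseteq> polys_on M"
    by (auto intro: single_in_polys_on)
  show "mpoly.subspace (polys_on M)"
    by (rule subspace_polys_on)
  fix T assume T: "(\<lambda>m. Poly_Mapping.single m (1::'a)) ` M \<subseteq> T" "mpoly.subspace T"
  show "polys_on M \<subseteq> T"
  proof
    fix p :: "'a mpoly" assume "p \<in> polys_on M"
    then have "Poly_Mapping.keys p \<subseteq> M"
      by (simp add: polys_on_def)
    then show "p \<in> T"
      using T by (subst mpoly_sum_monomials)
        (intro mpoly.subspace_sum mpoly.subspace_scale, auto)
  qed
qed

lemma inj_monomials: "inj_on (\<lambda>m. Poly_Mapping.single m (1::'k::field)) M"
proof (rule inj_onI)
  fix x y assume "Poly_Mapping.single x (1::'k) = Poly_Mapping.single y 1"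
  then have "Poly_Mapping.keys (Poly_Mapping.single x (1::'k)) = Poly_Mapping.keys (Poly_Mapping.single y (1::'k))"
    by simp
  then show "x = y"
    by simp
qed

lemma independent_monomials:
  "mpoly.independent ((\<lambda>m. Poly_Mapping.single m (1::'k::field)) ` M)"
  unfolding mpoly.independent_explicit_module
proof (intro allI impI)
  fix t :: "'k mpoly set" and u v
  assume t: "finite t" "t \<subseteq> (\<lambda>m. Poly_Mapping.single m 1) ` M"
    and sum: "(\<Sum>v\<in>t. scale_mpoly (u v) v) = 0" and v: "v \<in> t"
  obtain m where m: "v = Poly_Mapping.single m 1"
    using t(2) v by auto
  \<comment> \<open>Taking the coefficient at \<open>m\<close> is the dual functional of
    \<open>v\<close>: applied to the relation, it leaves only \<open>u v\<close>.\<close>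
  have "Poly_Mapping.lookup w m = (if w = v then 1 else 0)" if w: "w \<in> t" for w
  proof -
    obtain m' where m': "w = Poly_Mapping.single m' 1"
      using t(2) w by auto
    then have "w = v \<longleftrightarrow> m' = m"
      using m inj_onD[OF inj_monomials[of UNIV], of m' m] by auto
    then show ?thesis
      by (simp add: m' lookup_single when_def)
  qed
  then have "(\<Sum>w\<in>t. u w * Poly_Mapping.lookup w m) = (\<Sum>w\<in>t. if w = v then u w else 0)"
    by (intro sum.cong) auto
  also have "\<dots> = u v"
    using t(1) v by simp
  finally show "u v = 0"
    using arg_cong[OF sum, of "\<lambda>p. Poly_Mapping.lookup p m"]
    by (simp add: lookup_sum lookup_scale_mpoly)
qed

text \<open>Polynomials form an integral domain, so multiplication by \<open>P\<close> is an
  injective linear map and carries the monomial basis to a basis of the image. \<open>P = 1\<close>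
  gives the dimension of the space of forms, a product of linear forms that of an intersection of
  members.\<close>

lemma dim_multiples_polys_on:
  fixes P :: "'k::field mpoly"
  assumes "P \<noteq> 0"
  shows "mpoly.subspace ((\<lambda>q. q * P) ` polys_on M)"
    and "mpoly.dim ((\<lambda>q. q * P) ` polys_on M) = card M"
proof -
  let ?B = "(\<lambda>m. Poly_Mapping.single m (1::'k)) ` M"
  interpret L: linear scale_mpoly scale_mpoly "\<lambda>q. q * P"
    by unfold_locales (auto simp: scale_mpoly_conv_mult algebra_simps)
  have inj: "inj_on (\<lambda>q. q * P) X" for X
    using assms by (auto intro: inj_onI)
  have "(\<lambda>q. q * P) ` polys_on M = mpoly.span ((\<lambda>q. q * P) ` ?B)"
    by (simp add: L.span_image span_monomials)
  moreover have "mpoly.independent ((\<lambda>q. q * P) ` ?B)"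
    by (rule L.independent_injective_image[OF independent_monomials inj])
  ultimately show "mpoly.subspace ((\<lambda>q. q * P) ` polys_on M)"
    and "mpoly.dim ((\<lambda>q. q * P) ` polys_on M) = card M"
    by (simp_all add: mpoly.dim_eq_card_independent card_image[OF inj] card_image[OF inj_monomials])
qed

subsection \<open>Forms of a given degree\<close>

definition monoms :: "nat \<Rightarrow> nat \<Rightarrow> (nat \<Rightarrow>\<^sub>0 nat) set"
  where "monoms n e = {m. Poly_Mapping.keys m \<subseteq> {1..n} \<and> monom_degree m = e}"

lemma homogeneous_eq_polys_on: "homogeneous n e = polys_on (monoms n e)"
  by (auto simp: homogeneous_def mpolys_def polys_on_def monoms_def)

lemma monom_degree_eq_sum:
  assumes "finite I" "Poly_Mapping.keys m \<subseteq> I"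
  shows "monom_degree m = (\<Sum>i\<in>I. Poly_Mapping.lookup m i)"
  unfolding monom_degree_def
  by (rule sum.mono_neutral_left) (use assms in \<open>auto simp: in_keys_iff\<close>)

text \<open>Summing over the fixed set of indices instead of the keys of \<open>m\<close> makes
  additivity of the degree a matter of \<open>sum.distrib\<close>.\<close>

lemma monoms_eq: "monoms n e =
    {m. Poly_Mapping.keys m \<subseteq> {1..n} \<and> (\<Sum>i\<in>{1..n}. Poly_Mapping.lookup m i) = e}"
  using monom_degree_eq_sum[of "{1..n}"] by (auto simp: monoms_def)

lemma plus_in_monoms:
  assumes "a \<in> monoms n e" "b \<in> monoms n f"
  shows "a + b \<in> monoms n (e + f)"
  using assms keys_add[of a b] by (auto simp: monoms_eq lookup_add sum.distrib)

lemma monoms_0: "monoms n 0 = {0}"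
proof -
  have "m = 0" if "m \<in> monoms n 0" for m
    using that by (intro poly_mapping_eqI) (auto simp: monoms_def monom_degree_def in_keys_iff)
  then show ?thesis
    by (auto simp: monoms_def monom_degree_def)
qed

lemma single_in_monoms: "i \<in> {1..n} \<Longrightarrow> Poly_Mapping.single i 1 \<in> monoms n 1"
  by (simp add: monoms_def monom_degree_def)

lemma monoms_SucE:
  assumes "m \<in> monoms n (Suc e)"
  obtains i m' where "i \<in> {1..n}" "m' \<in> monoms n e" "m = Poly_Mapping.single i 1 + m'"
proof -
  from assms have "(\<Sum>i\<in>{1..n}. Poly_Mapping.lookup m i) \<noteq> 0"
    by (simp add: monoms_eq)
  then obtain i where i: "i \<in> {1..n}" "Poly_Mapping.lookup m i \<noteq> 0"
    by (meson sum.neutral)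
  \<comment> \<open>Subtraction of exponents is truncated, but the exponent at \<open>i\<close> is
    positive, so nothing is lost.\<close>
  define m' where "m' = m - Poly_Mapping.single i 1"
  have m: "m = Poly_Mapping.single i 1 + m'"
    using i by (intro poly_mapping_eqI) (auto simp: m'_def lookup_add lookup_minus lookup_single when_def)
  have "(\<Sum>j\<in>{1..n}. Poly_Mapping.lookup m j) = 1 + (\<Sum>j\<in>{1..n}. Poly_Mapping.lookup m' j)"
    using i(1) by (simp add: m lookup_add sum.distrib lookup_single when_def)
  moreover have "Poly_Mapping.keys m' \<subseteq> Poly_Mapping.keys m"
    by (auto simp: m in_keys_iff lookup_add)
  ultimately have "m' \<in> monoms n e"
    using assms by (auto simp: monoms_eq)
  then show thesis
    using that i(1) m by blast
qed

text \<open>Exponent vectors correspond to lists of length \<open>n\<close> with sum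
  \<open>e\<close>, which stars and bars counts.\<close>

lemma card_monoms: "card (monoms n e) = (n + e - 1) choose e"
proof -
  let ?L = "{l::nat list. length l = n \<and> sum_list l = e}"
  have "bij_betw (\<lambda>m. map (Poly_Mapping.lookup m) [1..<Suc n]) (monoms n e) ?L"
  \<comment> \<open>Variables are numbered from 1 and list positions from 0, hence the dummy entry 0
    in front; beyond its end the list defaults to 0.\<close>
  proof (rule bij_betw_byWitness[where f' = "\<lambda>l. Poly_Mapping.nth (0 # l)"])
    have sum: "(\<Sum>i\<in>{1..n}. Poly_Mapping.lookup (Poly_Mapping.nth (0 # l)) i) = sum_list l"
      if "length l = n" for l :: "nat list"
    proof -
      have "(\<Sum>i\<in>{1..n}. Poly_Mapping.lookup (Poly_Mapping.nth (0 # l)) i) = (\<Sum>i<n. l ! i)"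
        using that by (intro sum.reindex_bij_witness[of _ Suc "\<lambda>i. i - 1"])
          (auto simp: nth_default_nth nth_Cons')
      then show ?thesis
        using that by (simp add: sum_list_sum_nth atLeast0LessThan)
    qed
    show "\<forall>m\<in>monoms n e. Poly_Mapping.nth (0 # map (Poly_Mapping.lookup m) [1..<Suc n]) = m"
    proof
      fix m assume "m \<in> monoms n e"
      then have out: "Poly_Mapping.lookup m i = 0" if "i \<notin> {1..n}" for i
        using that by (auto simp: monoms_def in_keys_iff)
      show "Poly_Mapping.nth (0 # map (Poly_Mapping.lookup m) [1..<Suc n]) = m"
      proof (rule poly_mapping_eqI)
        fix i
        show "Poly_Mapping.lookup (Poly_Mapping.nth (0 # map (Poly_Mapping.lookup m) [1..<Suc n])) i
            = Poly_Mapping.lookup m i"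
          using out[of i] by (cases i) (auto simp: nth_default_def simp del: upt_Suc)
      qed
    qed
    show "\<forall>l\<in>?L. map (Poly_Mapping.lookup (Poly_Mapping.nth (0 # l))) [1..<Suc n] = l"
      by (auto intro!: nth_equalityI simp: nth_default_def simp del: upt_Suc)
    show "(\<lambda>m. map (Poly_Mapping.lookup m) [1..<Suc n]) ` monoms n e \<subseteq> ?L"
      by (auto simp: monoms_eq interv_sum_list_conv_sum_set_nat atLeastLessThanSuc_atLeastAtMost
               simp del: upt_Suc)
    show "(\<lambda>l. Poly_Mapping.nth (0 # l)) ` ?L \<subseteq> monoms n e"
      using sum by (auto simp del: keys_nth simp add: monoms_eq in_keys_iff nth_default_def nth_Cons'
          split: if_splits)
  qed
  then have "card (monoms n e) = card ?L"
    by (rule bij_betw_same_card)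
  then show ?thesis
    by (simp add: card_length_sum_list add.commute)
qed

text \<open>The cardinality alone does not settle this, as the binomial coefficient can be 0 and
  infinite sets have \<open>card\<close> 0.\<close>

lemma finite_monoms: "finite (monoms n e)"
proof (induction e)
  case (Suc e)
  have "monoms n (Suc e) \<subseteq> (\<Union>i\<in>{1..n}. (\<lambda>m. Poly_Mapping.single i 1 + m) ` monoms n e)"
    by (auto elim!: monoms_SucE)
  then show ?case
    by (rule finite_subset) (use Suc in auto)
qed (simp add: monoms_0)

lemma times_in_homogeneous:
  "p \<in> homogeneous n e \<Longrightarrow> q \<in> homogeneous n f \<Longrightarrow> p * q \<in> homogeneous n (e + f)"
  unfolding homogeneous_eq_polys_on by (erule (1) times_in_polys_on) (rule plus_in_monoms)

lemma zero_in_homogeneous [simp]: "0 \<in> homogeneous n e"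
  by (simp add: homogeneous_eq_polys_on)

lemma subspace_homogeneous: "mpoly.subspace (homogeneous n e)"
  unfolding homogeneous_eq_polys_on by (rule subspace_polys_on)

lemma homogeneous_0E:
  assumes "p \<in> homogeneous n 0"
  obtains c where "p = Poly_Mapping.single 0 c"
proof
  show "p = Poly_Mapping.single 0 (Poly_Mapping.lookup p 0)"
    using assms by (intro poly_mapping_eqI)
      (auto simp: homogeneous_eq_polys_on polys_on_iff monoms_0 lookup_single when_def)
qed

lemma linear_form_coeffE:
  assumes "y \<in> homogeneous n 1" "y \<noteq> 0"
  obtains k where "k \<in> {1..n}" "Poly_Mapping.lookup y (Poly_Mapping.single k 1) \<noteq> 0"
proof -
  obtain m where m: "Poly_Mapping.lookup y m \<noteq> 0"
    using assms(2) by (metis lookup_zero poly_mapping_eqI)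
  then have "m \<in> monoms n (Suc 0)"
    using assms(1) by (auto simp: homogeneous_eq_polys_on polys_on_iff)
  then obtain k m' where "k \<in> {1..n}" "m' \<in> monoms n 0" "m = Poly_Mapping.single k 1 + m'"
    by (rule monoms_SucE)
  with m show thesis
    using that by (simp add: monoms_0)
qed

subsection \<open>Division by a linear form\<close>

abbreviation free_monoms :: "nat \<Rightarrow> (nat \<Rightarrow>\<^sub>0 nat) set"
  where "free_monoms k \<equiv> {m. Poly_Mapping.lookup m k = 0}"

text \<open>The only monomial of degree one that involves x_k is x_k itself.\<close>

lemma linear_form_minus_leading_term:
  assumes "y \<in> homogeneous n 1"
    and a: "a = Poly_Mapping.lookup y (Poly_Mapping.single k 1)"
  shows "y - Poly_Mapping.single (Poly_Mapping.single k 1) a \<in> polys_on (free_monoms k)"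
  unfolding polys_on_iff
proof (intro allI impI)
  fix m assume m: "m \<notin> free_monoms k"
  show "Poly_Mapping.lookup (y - Poly_Mapping.single (Poly_Mapping.single k 1) a) m = 0"
  proof (cases "m \<in> monoms n 1")
    case True
    then obtain i where "m = Poly_Mapping.single i 1"
      by (auto simp: monoms_0 elim: monoms_SucE)
    moreover from this m have "i = k"
      by (auto simp: lookup_single when_def split: if_splits)
    ultimately show ?thesis
      by (simp add: a lookup_minus)
  next
    case False
    \<comment> \<open>If \<open>m\<close> is x_k here, then \<open>k\<close> lies outside the index
      range and \<open>a\<close>, the coefficient of \<open>y\<close> at \<open>m\<close>, vanishes
      as well.\<close>
    then have "Poly_Mapping.lookup y m = 0"
      using assms(1) by (auto simp: homogeneous_eq_polys_on polys_on_iff)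
    then show ?thesis
      by (auto simp: lookup_minus lookup_single when_def a)
  qed
qed

lemma lookup_single_times:
  "Poly_Mapping.lookup (Poly_Mapping.single t c * g) (t + m) = c * Poly_Mapping.lookup g m"
  for g :: "'k::field mpoly"
proof -
  have "Poly_Mapping.lookup (Poly_Mapping.single t c * g) (t + m)
      = (\<Sum>l. (c * (\<Sum>q. Poly_Mapping.lookup g q when t + m = l + q)) when t = l)"
    unfolding lookup_mult lookup_single when_mult ..
  also have "\<dots> = c * (\<Sum>q. Poly_Mapping.lookup g q when t + m = t + q)"
    by (rule Sum_any_when_equal')
  also have "\<dots> = c * Poly_Mapping.lookup g m"
    unfolding add_left_cancel Sum_any_when_equal' ..
  finally show ?thesis .
qed

text \<open>In \<open>y g\<close>, the terms of \<open>g\<close> of maximal degree in \<open>x\<^sub>k\<close> are multiplied by \<open>x\<^sub>k\<close> and cannot cancel.\<close>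

lemma multiple_of_linear_form_free:
  assumes y: "y \<in> homogeneous n 1" and nz: "Poly_Mapping.lookup y (Poly_Mapping.single k 1) \<noteq> 0"
    and free: "y * g \<in> polys_on (free_monoms k)"
  shows "g = 0"
proof (rule ccontr)
  assume "g \<noteq> 0"
  let ?x = "Poly_Mapping.single k 1 :: nat \<Rightarrow>\<^sub>0 nat"
  define a where "a = Poly_Mapping.lookup y ?x"
  define y' where "y' = y - Poly_Mapping.single ?x a"
  define E where "E = Max ((\<lambda>m. Poly_Mapping.lookup m k) ` Poly_Mapping.keys g)"
  have le: "Poly_Mapping.lookup m k \<le> E" if "m \<in> Poly_Mapping.keys g" for m
    using that by (simp add: E_def)
  have "Poly_Mapping.keys g \<noteq> {}"
    using \<open>g \<noteq> 0\<close> by (metis empty_iff in_keys_iff lookup_zero poly_mapping_eqI)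
  then have "E \<in> (\<lambda>m. Poly_Mapping.lookup m k) ` Poly_Mapping.keys g"
    unfolding E_def by (intro Max_in) auto
  then obtain m where m: "m \<in> Poly_Mapping.keys g" "Poly_Mapping.lookup m k = E"
    by auto
  \<comment> \<open>The factor \<open>y'\<close> is free of x_k, so its product with
    \<open>g\<close> keeps exponents of x_k at most \<open>E\<close>, whereas \<open>?x + m\<close>
    has exponent \<open>E + 1\<close>.\<close>
  have "y' * g \<in> polys_on {m. Poly_Mapping.lookup m k \<le> E}"
    by (rule times_in_polys_on[of _ "free_monoms k" _ "Poly_Mapping.keys g"])
       (use linear_form_minus_leading_term[OF y a_def] le in
         \<open>auto simp: y'_def polys_on_def lookup_add\<close>)
  then have "Poly_Mapping.lookup (y' * g) (?x + m) = 0"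
    by (simp add: polys_on_iff lookup_add m(2))
  moreover have "y * g = Poly_Mapping.single ?x a * g + y' * g"
    by (simp add: y'_def algebra_simps)
  ultimately have "Poly_Mapping.lookup (y * g) (?x + m) = a * Poly_Mapping.lookup g m"
    by (simp add: lookup_add lookup_single_times)
  moreover have "Poly_Mapping.lookup (y * g) (?x + m) = 0"
    using free by (simp add: polys_on_iff lookup_add)
  ultimately show False
    using nz m(1) by (auto simp: a_def in_keys_iff)
qed

text \<open>Division in degree one: a variable other than x_k is its own remainder, and x_k is
  replaced by solving \<open>y\<close> for it, with quotient the inverse of its coefficient.\<close>

lemma variable_mod_linear_form:
  assumes y: "y \<in> homogeneous n 1" and nz: "Poly_Mapping.lookup y (Poly_Mapping.single k 1) \<noteq> 0"
    and i: "i \<in> {1..n}"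
  obtains c l where "Poly_Mapping.single (Poly_Mapping.single i 1) 1 = c * y + l"
    "c \<in> homogeneous n 0" "l \<in> homogeneous n 1" "l \<in> polys_on (free_monoms k)"
proof -
  let ?x = "\<lambda>i. Poly_Mapping.single (Poly_Mapping.single i 1) :: 'a \<Rightarrow> 'a mpoly"
  have x: "?x i 1 \<in> homogeneous n 1"
    unfolding homogeneous_eq_polys_on by (intro single_in_polys_on single_in_monoms i)
  show thesis
  proof (cases "i = k")
    case False
    show thesis
      by (rule that[of 0 "?x i 1"])
         (use False x in \<open>auto intro!: single_in_polys_on simp: lookup_single when_def\<close>)
  next
    case True
    define a where "a = Poly_Mapping.lookup y (Poly_Mapping.single k 1)"
    define c :: "'a mpoly" where "c = Poly_Mapping.single 0 (1 / a)"
    have c: "c \<in> homogeneous n 0"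
      by (simp add: c_def homogeneous_eq_polys_on monoms_0 single_in_polys_on)
    have cx: "c * ?x k a = ?x k 1"
      using nz by (simp add: c_def a_def mult_single)
    have "c * (y - ?x k a) \<in> polys_on (free_monoms k)"
      unfolding c_def scale_mpoly_conv_mult[symmetric]
      by (intro mpoly.subspace_scale subspace_polys_on linear_form_minus_leading_term[OF y a_def])
    moreover have "c * (y - ?x k a) = - (?x k 1 - c * y)"
      by (simp only: cx right_diff_distrib minus_diff_eq)
    ultimately have "?x k 1 - c * y \<in> polys_on (free_monoms k)"
      using mpoly.subspace_neg[OF subspace_polys_on] by fastforce
    moreover have "?x k 1 - c * y \<in> homogeneous n 1"
      using x True times_in_homogeneous[OF c y]
      by (intro mpoly.subspace_diff subspace_homogeneous) auto
    ultimately show thesis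
      using that[of c "?x k 1 - c * y"] c True by simp
  qed
qed

text \<open>Induction on the degree, with linearity reducing the step to monomials. The clause for
  \<open>e = 0\<close> is there because \<open>e - 1\<close> is truncated and would admit a constant
  quotient.\<close>

lemma division_by_linear_form:
  assumes y: "y \<in> homogeneous n 1" and nz: "Poly_Mapping.lookup y (Poly_Mapping.single k 1) \<noteq> 0"
    and "h \<in> homogeneous n e"
  shows "\<exists>q r. h = q * y + r \<and> q \<in> homogeneous n (e - 1) \<and> (e = 0 \<longrightarrow> q = 0) \<and>
    r \<in> homogeneous n e \<and> r \<in> polys_on (free_monoms k)"
  using assms(3)
proof (induction e arbitrary: h)
  case 0
  have "h \<in> polys_on (free_monoms k)"
    using 0 by (auto simp: homogeneous_eq_polys_on monoms_0 polys_on_def)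
  then show ?case
    using 0 by (intro exI[of _ 0] exI[of _ h]) simp
next
  case (Suc e)
  define T where "T = {h. \<exists>q r. h = q * y + r \<and> q \<in> homogeneous n e \<and>
    r \<in> homogeneous n (Suc e) \<and> r \<in> polys_on (free_monoms k)}"
  note [intro] = mpoly.subspace_add[OF subspace_homogeneous] mpoly.subspace_add[OF subspace_polys_on]
    mpoly.subspace_scale[OF subspace_homogeneous] mpoly.subspace_scale[OF subspace_polys_on]
  have "mpoly.subspace T"
  proof (rule mpoly.subspaceI)
    show "0 \<in> T"
      unfolding T_def by (auto intro!: exI[of _ 0])
  next
    fix g h assume "g \<in> T" "h \<in> T"
    then obtain q r q' r' where *: "g = q * y + r" "h = q' * y + r'"
      "q \<in> homogeneous n e" "q' \<in> homogeneous n e"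
      "r \<in> homogeneous n (Suc e)" "r' \<in> homogeneous n (Suc e)"
      "r \<in> polys_on (free_monoms k)" "r' \<in> polys_on (free_monoms k)"
      unfolding T_def by blast
    have "g + h = (q + q') * y + (r + r')"
      by (simp add: * algebra_simps)
    then show "g + h \<in> T"
      unfolding T_def using * by blast
  next
    fix c h assume "h \<in> T"
    then obtain q r where *: "h = q * y + r" "q \<in> homogeneous n e"
      "r \<in> homogeneous n (Suc e)" "r \<in> polys_on (free_monoms k)"
      unfolding T_def by blast
    have "scale_mpoly c h = scale_mpoly c q * y + scale_mpoly c r"
      by (simp add: * scale_mpoly_conv_mult algebra_simps)
    then show "scale_mpoly c h \<in> T"
      unfolding T_def using * by blast
  qed
  moreover have "(\<lambda>m. Poly_Mapping.single m 1) ` monoms n (Suc e) \<subseteq> T"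
  proof safe
    fix m assume "m \<in> monoms n (Suc e)"
    then obtain i m' where i: "i \<in> {1..n}" and m': "m' \<in> monoms n e"
      and m: "m = Poly_Mapping.single i 1 + m'"
      by (rule monoms_SucE)
    let ?x = "Poly_Mapping.single (Poly_Mapping.single i 1) 1 :: 'a mpoly"
    have "Poly_Mapping.single m' (1::'a) \<in> homogeneous n e"
      using m' by (simp add: homogeneous_eq_polys_on single_in_polys_on)
    from Suc.IH[OF this] obtain q r where
      qr: "Poly_Mapping.single m' 1 = q * y + r" "q \<in> homogeneous n (e - 1)" "e = 0 \<Longrightarrow> q = 0"
        "r \<in> homogeneous n e" "r \<in> polys_on (free_monoms k)"
      by blast
    obtain c l where cl: "?x = c * y + l" "c \<in> homogeneous n 0" "l \<in> homogeneous n 1"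
      "l \<in> polys_on (free_monoms k)"
      using variable_mod_linear_form[OF y nz i] .
    have x: "?x \<in> homogeneous n 1"
      unfolding homogeneous_eq_polys_on by (intro single_in_polys_on single_in_monoms i)
    \<comment> \<open>For \<open>e = 0\<close> the degrees do not match, but then \<open>q\<close>
      is 0.\<close>
    have "?x * q \<in> homogeneous n e"
      using times_in_homogeneous[OF x qr(2)] qr(3) by (cases "e = 0") auto
    then have "?x * q + c * r \<in> homogeneous n e"
      using times_in_homogeneous[OF cl(2) qr(4)] by auto
    moreover have "l * r \<in> homogeneous n (Suc e)"
      using times_in_homogeneous[OF cl(3) qr(4)] by simp
    moreover have "l * r \<in> polys_on (free_monoms k)"
      using cl(4) qr(5) by (rule times_in_polys_on) (simp add: lookup_add)
    \<comment> \<open>The variable is reduced modulo \<open>y\<close> only in front of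
      \<open>r\<close>; the new remainder \<open>l * r\<close> is a product of factors free of
      x_k.\<close>
    moreover have "Poly_Mapping.single m 1 = (?x * q + c * r) * y + l * r"
    proof -
      have "Poly_Mapping.single m 1 = ?x * Poly_Mapping.single m' 1"
        by (simp add: m mult_single)
      also have "\<dots> = ?x * q * y + ?x * r"
        by (simp add: qr(1) algebra_simps)
      also have "?x * r = c * r * y + l * r"
        by (subst cl(1)) (simp add: algebra_simps)
      finally show ?thesis
        by (simp add: algebra_simps)
    qed
    ultimately show "Poly_Mapping.single m 1 \<in> T"
      unfolding T_def by blast
  qed
  ultimately have "polys_on (monoms n (Suc e)) \<subseteq> T"
    using mpoly.span_minimal span_monomials by metis
  then show ?case
    using Suc.prems by (auto simp: T_def homogeneous_eq_polys_on)
qed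

text \<open>Divisibility in the ring says nothing about the degree of the cofactor. Division with
  remainder supplies a homogeneous quotient; its remainder is a multiple of \<open>y\<close> free of
  x_k, hence 0.\<close>

lemma dvd_homogeneousE:
  assumes y: "y \<in> homogeneous n 1" "y \<noteq> 0" and h: "h \<in> homogeneous n e" and "y dvd h"
  obtains q where "h = q * y" "q \<in> homogeneous n (e - 1)" "e = 0 \<Longrightarrow> q = 0"
proof -
  obtain k where nz: "Poly_Mapping.lookup y (Poly_Mapping.single k 1) \<noteq> 0"
    using linear_form_coeffE[OF y] .
  obtain q r where qr: "h = q * y + r" "q \<in> homogeneous n (e - 1)" "e = 0 \<longrightarrow> q = 0"
    "r \<in> polys_on (free_monoms k)"
    using division_by_linear_form[OF y(1) nz h] by blast
  have "y dvd r"
    using \<open>y dvd h\<close> by (simp add: qr(1) dvd_add_right_iff)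
  then have "r = 0"
    using multiple_of_linear_form_free[OF y(1) nz] qr(4) by (auto elim: dvdE)
  then show thesis
    using qr by (intro that[of q]) auto
qed

text \<open>Modulo \<open>y\<close> the product is that of the two remainders. This is free of x_k
  and divisible by \<open>y\<close>, so it is 0, and one remainder vanishes.\<close>

lemma linear_form_prime:
  assumes y: "y \<in> homogeneous n 1" "y \<noteq> 0" and g: "g \<in> homogeneous n e"
    and h: "h \<in> homogeneous n f" and "y dvd g * h"
  shows "y dvd g \<or> y dvd h"
proof -
  obtain k where nz: "Poly_Mapping.lookup y (Poly_Mapping.single k 1) \<noteq> 0"
    using linear_form_coeffE[OF y] .
  obtain q r where qr: "g = q * y + r" "r \<in> polys_on (free_monoms k)"
    using division_by_linear_form[OF y(1) nz g] by blast
  obtain q' r' where qr': "h = q' * y + r'" "r' \<in> polys_on (free_monoms k)"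
    using division_by_linear_form[OF y(1) nz h] by blast
  have "g * h = y * (q * h + r * q') + r * r'"
    by (simp add: qr(1) qr'(1) algebra_simps)
  then have "y dvd r * r'"
    using \<open>y dvd g * h\<close> by (metis dvd_add_right_iff dvd_triv_left)
  moreover have "r * r' \<in> polys_on (free_monoms k)"
    using qr(2) qr'(2) by (rule times_in_polys_on) (simp add: lookup_add)
  ultimately have "r * r' = 0"
    using multiple_of_linear_form_free[OF y(1) nz] by (metis dvdE mult_zero_right)
  then show ?thesis
    by (auto simp: qr(1) qr'(1))
qed

text \<open>The cofactor has degree 0, so it is a nonzero constant and can be inverted.\<close>

lemma linear_form_dvd_sym:
  assumes y: "y \<in> homogeneous n 1" "y \<noteq> 0" and z: "z \<in> homogeneous n 1" "z \<noteq> 0" and "y dvd z"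
  shows "z dvd y"
proof -
  obtain q where q: "z = q * y" "q \<in> homogeneous n (1 - 1)"
    using dvd_homogeneousE[OF y z(1) \<open>y dvd z\<close>] .
  from q(2) obtain c where c: "q = Poly_Mapping.single 0 c"
    by (auto elim: homogeneous_0E)
  with z(2) q(1) have "c \<noteq> 0"
    by auto
  then have "Poly_Mapping.single 0 (1 / c) * z = y"
    by (simp add: q(1) c mult_single flip: mult.assoc)
  then show ?thesis
    by (metis dvd_triv_right)
qed

subsection \<open>Products of linear forms\<close>

lemma prod_linear_forms_homogeneous:
  assumes "finite Y" "Y \<subseteq> homogeneous n 1"
  shows "\<Prod>Y \<in> homogeneous n (card Y)"
  using assms
proof (induction Y)
  case empty
  then show ?case
    by (simp add: homogeneous_eq_polys_on monoms_0 single_in_polys_on flip: single_one)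
next
  case (insert y Y)
  then show ?case
    using times_in_homogeneous[of y n 1 "\<Prod>Y" "card Y"] by simp
qed

text \<open>Primality removes the factors in \<open>Y\<close> one at a time.\<close>

lemma linear_form_dvd_prod_mult:
  assumes "finite Y" "Y \<subseteq> homogeneous n 1" "y \<in> homogeneous n 1" "y \<noteq> 0"
    "\<And>z. z \<in> Y \<Longrightarrow> \<not> y dvd z" "h \<in> homogeneous n e" "y dvd h * \<Prod>Y"
  shows "y dvd h"
  using assms
proof (induction Y)
  case (insert z Y)
  have "h * \<Prod>Y \<in> homogeneous n (e + card Y)"
    using insert by (intro times_in_homogeneous prod_linear_forms_homogeneous) auto
  moreover have "y dvd z * (h * \<Prod>Y)"
    using insert.prems(6) insert.hyps by (simp add: mult.left_commute)
  ultimately have "y dvd h * \<Prod>Y"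
    using linear_form_prime[of y n z 1] insert.prems by blast
  then show ?case
    using insert by auto
qed auto

text \<open>Induction on \<open>Y\<close>: a new \<open>y\<close> divides
  \<open>p = q * \<Prod>Y\<close> but no factor in \<open>Y\<close>, so it divides \<open>q\<close>,
  whose degree drops by one. The last clause records what truncation of \<open>d - card Y\<close>
  hides: more than \<open>d\<close> factors force the quotient to be 0.\<close>

lemma prod_linear_forms_divides:
  assumes "finite Y" "Y \<subseteq> homogeneous n 1 - {0}" "pairwise (\<lambda>y z. \<not> y dvd z) Y"
    "p \<in> homogeneous n d" "\<And>y. y \<in> Y \<Longrightarrow> y dvd p"
  shows "\<exists>q\<in>homogeneous n (d - card Y). p = q * \<Prod>Y \<and> (d < card Y \<longrightarrow> q = 0)"
  using assms
proof (induction Y)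
  case (insert y Y)
  then obtain q where q: "q \<in> homogeneous n (d - card Y)" "p = q * \<Prod>Y" "d < card Y \<longrightarrow> q = 0"
    by (auto simp: pairwise_insert)
  have "y dvd q"
  proof (rule linear_form_dvd_prod_mult[OF insert.hyps(1)])
    show "\<not> y dvd z" if "z \<in> Y" for z
      using that insert by (auto simp: pairwise_insert)
  qed (use insert q in auto)
  then obtain r where r: "q = r * y" "r \<in> homogeneous n (d - card Y - 1)" "d - card Y = 0 \<Longrightarrow> r = 0"
    using dvd_homogeneousE[of y n q "d - card Y"] insert.prems(1) q(1) by blast
  show ?case
  proof (intro bexI[of _ r] conjI)
    show "p = r * \<Prod>(insert y Y)"
      using insert.hyps by (simp add: q(2) r(1) mult.assoc)
  qed (use r insert.hyps in auto)
qed auto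

subsection \<open>The members of the arc and their intersections\<close>

text \<open>With members described by divisibility, an intersection becomes a set of forms with
  several prescribed divisors.\<close>

lemma multiples_eq_dvd:
  fixes y :: "'k::field mpoly"
  assumes "y \<in> homogeneous n 1" "y \<noteq> 0" "d \<ge> 1"
  shows "{g * y |g. g \<in> homogeneous n (d - 1)} = {p \<in> homogeneous n d. y dvd p}"
proof safe
  fix g :: "'k mpoly" assume "g \<in> homogeneous n (d - 1)"
  then show "g * y \<in> homogeneous n d"
    using times_in_homogeneous[of g n "d - 1" y 1] assms by simp
next
  fix p :: "'k mpoly" assume "p \<in> homogeneous n d" "y dvd p"
  then show "\<exists>g. p = g * y \<and> g \<in> homogeneous n (d - 1)"
    using dvd_homogeneousE[OF assms(1,2)] by metis
qed auto

lemma Inter_members: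
  fixes S :: "'k::field mpoly set set"
  assumes d: "d \<ge> 1" and "finite S" "S \<noteq> {}"
    and S: "S \<subseteq> {{g * y |g. g \<in> homogeneous n (d - 1)} |y. y \<in> homogeneous n 1 \<and> y \<noteq> 0}"
  obtains P where "P \<noteq> 0"
    "\<Inter>S = (if card S \<le> d then (\<lambda>q. q * P) ` homogeneous n (d - card S) else {0})"
proof -
  have "\<exists>y. y \<in> homogeneous n 1 \<and> y \<noteq> 0 \<and> (\<forall>p. p \<in> U \<longleftrightarrow> p \<in> homogeneous n d \<and> y dvd p)"
    if U: "U \<in> S" for U
  proof -
    obtain y where y: "y \<in> homogeneous n 1" "y \<noteq> 0"
      and "U = {g * y |g. g \<in> homogeneous n (d - 1)}"
      using S U by blast
    then have "U = {p \<in> homogeneous n d. y dvd p}"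
      using multiples_eq_dvd[OF y d] by simp
    then show ?thesis
      using y by auto
  qed
  \<comment> \<open>A member does not determine its generator, so \<open>f\<close> chooses one for
    each.\<close>
  then obtain f where f: "\<And>U. U \<in> S \<Longrightarrow> f U \<in> homogeneous n 1" "\<And>U. U \<in> S \<Longrightarrow> f U \<noteq> 0"
    "\<And>U p. U \<in> S \<Longrightarrow> p \<in> U \<longleftrightarrow> p \<in> homogeneous n d \<and> f U dvd p"
    by metis
  \<comment> \<open>Generators of which one divides the other divide each other, hence have the same
    multiples. Distinct members thus have generators not dividing one another.\<close>
  have eq: "U = V" if UV: "U \<in> S" "V \<in> S" "f U dvd f V" for U V
  proof -
    have "f V dvd f U"
      using linear_form_dvd_sym f UV by blast
    then show ?thesis
      using f(3)[OF UV(1)] f(3)[OF UV(2)] UV(3) by (auto intro: dvd_trans)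
  qed
  define Y where "Y = f ` S"
  have inj: "inj_on f S"
    using eq by (intro inj_onI) auto
  have card: "card Y = card S"
    by (simp add: Y_def card_image[OF inj])
  have finY: "finite Y"
    using \<open>finite S\<close> by (simp add: Y_def)
  have Y: "Y \<subseteq> homogeneous n 1 - {0}"
    using f by (auto simp: Y_def)
  have pw: "pairwise (\<lambda>y z. \<not> y dvd z) Y"
    using eq by (auto simp: pairwise_def Y_def)
  have Inter: "\<Inter>S = {p \<in> homogeneous n d. \<forall>y\<in>Y. y dvd p}"
    using f(3) \<open>S \<noteq> {}\<close> by (auto simp: Y_def)
  have nz: "\<Prod>Y \<noteq> 0"
    using finY Y by (auto simp: prod_zero_iff)
  have div: "\<exists>q\<in>homogeneous n (d - card S). p = q * \<Prod>Y \<and> (d < card S \<longrightarrow> q = 0)"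
    if "p \<in> \<Inter>S" for p
    using prod_linear_forms_divides[OF finY Y pw, of p d] that by (auto simp: Inter card)
  show thesis
  proof (rule that[OF nz])
    show "\<Inter>S = (if card S \<le> d then (\<lambda>q. q * \<Prod>Y) ` homogeneous n (d - card S) else {0})"
    proof (cases "card S \<le> d")
      case True
      have "q * \<Prod>Y \<in> \<Inter>S" if "q \<in> homogeneous n (d - card S)" for q
      proof -
        have "\<Prod>Y \<in> homogeneous n (card S)"
          using prod_linear_forms_homogeneous[OF finY, of n] Y card by auto
        then have "q * \<Prod>Y \<in> homogeneous n d"
          using times_in_homogeneous[OF that] True by fastforce
        then show ?thesis
          using finY by (auto simp: Inter intro!: dvd_mult dvd_prodI)
      qed
      then show ?thesis
        using True div by (auto simp: image_iff)
    next
      case False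
      moreover have "0 \<in> \<Inter>S"
        by (simp add: Inter)
      ultimately show ?thesis
        using div by force
    qed
  qed
qed

section \<open>The vector dimensions of the arc\<close>

theorem theorem6p1:
  fixes n d :: nat and D :: "'k::field mpoly set set" and nd :: "nat \<Rightarrow> nat"
  assumes "n > 1" and "d \<ge> 2"
    and "D = {{g * y | g. g \<in> homogeneous n (d - 1)} | y. y \<in> homogeneous n 1 \<and> y \<noteq> 0}"
    and "nd = (\<lambda>j. (n + d - j - 1) choose (d - j))"
  shows "mpoly.generalized_dual_arc (homogeneous n d) d ((n + d - 1) choose d) nd D
    \<and> nd 1 = (n + d - 2) choose (d - 1) \<and> nd (d - 1) = n \<and> nd d = 1"
proof -
  have dim: "mpoly.dim (homogeneous n d :: 'k mpoly set) = (n + d - 1) choose d"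
    using dim_multiples_polys_on(2)[of "1 :: 'k mpoly" "monoms n d"]
    by (simp add: homogeneous_eq_polys_on card_monoms)
  have span: "\<exists>B. finite B \<and> mpoly.span B = (homogeneous n d :: 'k mpoly set)"
    unfolding homogeneous_eq_polys_on using finite_monoms span_monomials by blast
  have card_nd: "card (monoms n (d - j)) = nd j" if "j \<le> d" for j
    using that by (simp add: card_monoms assms(4))
  have Inter_D: "\<exists>P. P \<noteq> 0 \<and>
      \<Inter>S = (if card S \<le> d then (\<lambda>q. q * P) ` homogeneous n (d - card S) else {0})"
    if "S \<subseteq> D" "card S \<ge> 1" for S
  proof -
    \<comment> \<open>Infinite sets have \<open>card\<close> 0, so \<open>card S \<ge> 1\<close>
      yields finiteness too.\<close>
    have "d \<ge> 1" "finite S" "S \<noteq> {}"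
      using that assms(2) by (auto intro: card_ge_0_finite)
    then show ?thesis
      using that(1) unfolding assms(3) by (rule Inter_members) blast
  qed
  have Inter: "mpoly.subspace (\<Inter>S) \<and> mpoly.dim (\<Inter>S) = nd (card S)"
    if "S \<subseteq> D" "card S \<ge> 1" "card S \<le> d" for S
  proof -
    obtain P where "P \<noteq> 0" "\<Inter>S = (\<lambda>q. q * P) ` homogeneous n (d - card S)"
      using Inter_D[OF \<open>S \<subseteq> D\<close> \<open>card S \<ge> 1\<close>] \<open>card S \<le> d\<close> by auto
    then show ?thesis
      using dim_multiples_polys_on[of P] that by (simp add: homogeneous_eq_polys_on card_nd)
  qed
  have Inter0: "\<Inter>S = {0}" if "S \<subseteq> D" "card S = d + 1" for S
    using Inter_D[OF that(1)] that(2) by auto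
  \<comment> \<open>A member is the intersection of the family consisting of it alone, so its
    dimension is the case \<open>j = 1\<close>.\<close>
  have members: "mpoly.subspace U \<and> U \<subseteq> homogeneous n d \<and> mpoly.dim U = nd 1" if "U \<in> D" for U
  proof -
    obtain y where y: "y \<in> homogeneous n 1" "y \<noteq> 0" "U = {g * y |g. g \<in> homogeneous n (d - 1)}"
      using \<open>U \<in> D\<close> unfolding assms(3) by blast
    have "U \<subseteq> homogeneous n d"
      using multiples_eq_dvd[OF y(1,2), of d] y(3) assms(2) by auto
    then show ?thesis
      using Inter[of "{U}"] that assms(2) by simp
  qed
  have pos: "nd j > 0" if "j \<in> {2..d}" for j
    using that assms(1) by (auto simp: assms(4))
  have "mpoly.generalized_dual_arc (homogeneous n d) d ((n + d - 1) choose d) nd D"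
    unfolding mpoly.generalized_dual_arc_def
    using subspace_homogeneous dim span members pos Inter Inter0 by auto
  moreover have "nd 1 = (n + d - 2) choose (d - 1)" "nd (d - 1) = n" "nd d = 1"
    using assms(1,2) by (auto simp: assms(4) numeral_2_eq_2)
  ultimately show ?thesis
    by blast
qed

end
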